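(* Let $S$ be an upper subsemigroup of the bicyclic monoid $\mathcal{B}$. The following are equivalent: (i) $S$ is a left I-order in $\mathcal{B}$; (ii) $R_1\subseteq S$. Moreover, writing $S$ as $S=F_D\cup\bigcup_{i\in I}S_i$ with $S_i=F_i\cup\Lambda_{i,m_i,d}$ (as in the definition of an upper subsemigroup), we have $R_1\subseteq S$ if and only if $0\in I$, $d=1$ and $F_D\cup F_0=\{a^0b^j : 0\le j\le m_0-1\}$.
   Context: The bicyclic monoid $\mathcal{B}$ is the monoid generated by $a,b$ subject to $ba=1$; its elements are uniquely of the form $a^ib^j$ with $i,j\ge 0$, with $a^kb^l\,a^mb^n=a^{k-l+t}b^{n-m+t}$ where $t=\max\{l,m\}$. It is an inverse monoid with $(a^ib^j)^{-1}=a^jb^i$. A subsemigroup $S$ of an inverse semigroup $Q$ is a left I-order in $Q$ if every element of $Q$ can be written as $s^{-1}t$ with $s,t\in S$. $R_1=\{a^0b^j : j\ge 0\}$ is the $\mathcal{R}$-class of the identity. Notation: $\mathbb{N}$ is the set of positive integers, $\mathbb{N}^0=\mathbb{N}\cup\{0\}$; $D=\{a^ib^i: i\ge 0\}$; $L^p=\{a^ib^j: 0\le j\le p,\ i\ge 0\}$ for $p\ge 0$; for $i,m\ge 0$ and $d>0$, $\Lambda_{i,m,d}=\{a^ib^j : d\mid j-i,\ j\ge m\}$. An upper subsemigroup of $\mathcal{B}$ is a subsemigroup $S$ of the form $S=F_D\cup\bigcup_{i\in I}S_i$, where $d\in\mathbb{N}$, $\emptyset\ne I\subseteq\mathbb{N}^0$,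 $F_D\subseteq D\cap L^{\min(I)}$, and for each $i\in I$, $S_i\subseteq\Lambda_{i,i,d}$ has the form $S_i=F_i\cup\Lambda_{i,m_i,d}$ for some $m_i\in\mathbb{N}^0$ and some finite set $F_i$; moreover $I=I_0\cup\{r+ud : r\in R,\ u\in\mathbb{N}^0,\ r+ud\ge N\}$ for some (possibly empty) $R\subseteq\{0,\dots,d-1\}$, some $N\in\mathbb{N}^0$ and some finite $I_0\subseteq\{0,\dots,N-1\}$.
   Formalization: The equality for F_D ∪ F_0 is proved when, if 0 ∈ I, F_D ∪ F_0 is disjoint from Λ_{0,m_0,d}; without this it fails (S=R_1, m_0=3, F_0={1,…,b^5}). For all decompositions it is proved with {a^0b^j : 0≤j≤m_0−1} ⊆ F_D ∪ F_0 in place of equality. *)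

theory Defs
  imports Main
begin

section \<open>Inverse semigroups and left I-orders\<close>

class inverse_semigroup = semigroup_mult +
  assumes unique_inverse: "\<exists>!y. x * y * x = x \<and> y * x * y = y"

definition sinv :: "'a::inverse_semigroup \<Rightarrow> 'a" where
  "sinv x = (THE y. x * y * x = x \<and> y * x * y = y)"

definition subsemigroup :: "'a::semigroup_mult set \<Rightarrow> bool" where
  "subsemigroup S \<longleftrightarrow> S \<noteq> {} \<and> (\<forall>s\<in>S. \<forall>t\<in>S. s * t \<in> S)"

definition left_I_order :: "'a::inverse_semigroup set \<Rightarrow> bool" where
  "left_I_order S \<longleftrightarrow> subsemigroup S \<and> (\<forall>q. \<exists>s\<in>S. \<exists>t\<in>S. q = sinv s * t)"


section \<open>The bicyclic monoid\<close>

text \<open>\<open>AB i j\<close> is the normal form of \<open>a\<^sup>i b\<^sup>j\<close>; see lemmas \<open>AB_eq\<close> and \<open>bicyclic_universal\<close>.\<close>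

datatype bicyclic = AB nat nat

instantiation bicyclic :: monoid_mult
begin

definition "1 = AB 0 0"

text \<open>The truncated subtractions below are exact, as \<open>t \<ge> l\<close> and \<open>t \<ge> m\<close>: the product is
  \<open>a\<^sup>k\<^sup>-\<^sup>l\<^sup>+\<^sup>t b\<^sup>n\<^sup>-\<^sup>m\<^sup>+\<^sup>t\<close>.\<close>

fun times_bicyclic :: "bicyclic \<Rightarrow> bicyclic \<Rightarrow> bicyclic" where
  "AB k l * AB m n = (let t = max l m in AB (k + (t - l)) (n + (t - m)))"

instance
proof
  fix x y z :: bicyclic
  show "x * y * z = x * (y * z)"
    by (cases x; cases y; cases z) (auto simp: Let_def max_def)
  show "1 * x = x" "x * 1 = x"
    by (cases x; simp add: one_bicyclic_def Let_def)+
qed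

end

definition gen_a :: bicyclic where "gen_a = AB 1 0"
definition gen_b :: bicyclic where "gen_b = AB 0 1"

lemma gen_b_gen_a: "gen_b * gen_a = 1"
  by (simp add: gen_a_def gen_b_def one_bicyclic_def)

lemma gen_a_power: "gen_a ^ i = AB i 0"
  by (induction i) (auto simp: gen_a_def one_bicyclic_def Let_def)

lemma gen_b_power: "gen_b ^ j = AB 0 j"
  by (induction j) (auto simp: gen_b_def one_bicyclic_def Let_def)

lemma AB_eq: "AB i j = gen_a ^ i * gen_b ^ j"
  by (simp add: gen_a_power gen_b_power Let_def)

lemma power_cancel:
  fixes x y :: "'m::monoid_mult"
  assumes "y * x = 1"
  shows "y ^ l * x ^ m = x ^ (m - l) * y ^ (l - m)"
proof (induction l arbitrary: m)
  case (Suc l)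
  show ?case
  proof (cases m)
    case (Suc k)
    have "y ^ Suc l * x ^ Suc k = y ^ l * (y * x) * x ^ k"
      by (simp only: power_Suc2[of y] power_Suc[of x] mult.assoc)
    then show ?thesis
      using Suc Suc.IH[of k] assms by simp
  qed simp
qed simp

lemma bicyclic_universal:
  fixes x y :: "'m::monoid_mult"
  assumes yx: "y * x = 1"
  shows "\<exists>!h. h 1 = 1 \<and> (\<forall>p q. h (p * q) = h p * h q) \<and> h gen_a = x \<and> h gen_b = y"
proof (rule ex1I)
  let ?h = "\<lambda>p. case p of AB i j \<Rightarrow> x ^ i * y ^ j"
  have "?h (p * q) = ?h p * ?h q" for p q
  proof (cases p; cases q)
    fix k l m n assume pq: "p = AB k l" "q = AB m n"
    have "?h p * ?h q = x ^ k * (y ^ l * x ^ m) * y ^ n"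
      by (simp add: pq mult.assoc)
    also have "\<dots> = x ^ (k + (m - l)) * y ^ (l - m + n)"
      by (simp only: power_cancel[OF yx] power_add mult.assoc)
    also have "\<dots> = ?h (p * q)"
      by (auto simp: pq Let_def max_def add.commute)
    finally show ?thesis by simp
  qed
  then show "?h 1 = 1 \<and> (\<forall>p q. ?h (p * q) = ?h p * ?h q) \<and> ?h gen_a = x \<and> ?h gen_b = y"
    by (simp add: one_bicyclic_def gen_a_def gen_b_def)
next
  fix h :: "bicyclic \<Rightarrow> 'm"
  assume h: "h 1 = 1 \<and> (\<forall>p q. h (p * q) = h p * h q) \<and> h gen_a = x \<and> h gen_b = y"
  have "h (gen_a ^ i) = x ^ i" for i by (induction i) (simp_all add: h)
  moreover have "h (gen_b ^ i) = y ^ i" for i by (induction i) (simp_all add: h)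
  ultimately have "h (AB i j) = x ^ i * y ^ j" for i j by (simp only: AB_eq h)
  then show "h = (\<lambda>p. case p of AB i j \<Rightarrow> x ^ i * y ^ j)"
    by (auto simp: fun_eq_iff split: bicyclic.split)
qed

lemma bicyclic_inverse_iff:
  "AB i j * y * AB i j = AB i j \<and> y * AB i j * y = y \<longleftrightarrow> y = AB j i"
  by (cases y) (auto simp: Let_def max_def split: if_splits)

instance bicyclic :: inverse_semigroup
proof
  fix x :: bicyclic
  show "\<exists>!y. x * y * x = x \<and> y * x * y = y"
    by (cases x) (simp only: bicyclic_inverse_iff, blast)
qed

lemma sinv_AB: "sinv (AB i j) = AB j i"
  unfolding sinv_def bicyclic_inverse_iff by simp

definition R1 :: "bicyclic set" where
  "R1 = {AB 0 j |j. True}"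

text \<open>In a monoid, the elements \<open>\<R>\<close>-related to \<open>1\<close> are the right invertible ones.\<close>

lemma R1_eq: "R1 = {x. \<exists>u. x * u = 1}"
proof -
  have "(\<exists>u. AB i j * u = 1) \<longleftrightarrow> i = 0" for i j
  proof
    assume "\<exists>u. AB i j * u = 1"
    then obtain k l where "AB i j * AB k l = 1" by (metis bicyclic.exhaust)
    then show "i = 0" by (auto simp: one_bicyclic_def Let_def max_def split: if_splits)
  next
    assume "i = 0"
    then have "AB i j * AB j 0 = 1" by (simp add: one_bicyclic_def Let_def)
    then show "\<exists>u. AB i j * u = 1" by blast
  qed
  then have "x \<in> R1 \<longleftrightarrow> (\<exists>u. x * u = 1)" for x
    by (cases x) (simp add: R1_def)
  then show ?thesis by blast
qed


section \<open>Upper subsemigroups\<close>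

definition Diag :: "bicyclic set" where
  "Diag = {AB i i |i. True}"

definition Lset :: "nat \<Rightarrow> bicyclic set" where
  "Lset p = {AB i j |i j. j \<le> p}"

definition Lam :: "nat \<Rightarrow> nat \<Rightarrow> nat \<Rightarrow> bicyclic set" where
  "Lam i m d = {AB i j |j. int d dvd int j - int i \<and> m \<le> j}"

definition eventually_periodic_index :: "nat \<Rightarrow> nat set \<Rightarrow> bool" where
  "eventually_periodic_index d I \<longleftrightarrow>
     (\<exists>R N I0. R \<subseteq> {..<d} \<and> finite I0 \<and> I0 \<subseteq> {..<N} \<and>
        I = I0 \<union> {r + u * d |r u. r \<in> R \<and> N \<le> r + u * d})"

text \<open>\<open>I\<close> may be infinite, so its minimum is \<open>Inf I\<close>. The values of \<open>F\<close> and \<open>m\<close>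
  outside \<open>I\<close> are irrelevant.\<close>

definition upper_decomposition ::
  "bicyclic set \<Rightarrow> nat \<Rightarrow> nat set \<Rightarrow> bicyclic set \<Rightarrow> (nat \<Rightarrow> bicyclic set) \<Rightarrow> (nat \<Rightarrow> nat) \<Rightarrow> bool"
where
  "upper_decomposition S d I FD F m \<longleftrightarrow>
     0 < d \<and> I \<noteq> {} \<and> eventually_periodic_index d I \<and>
     FD \<subseteq> Diag \<inter> Lset (Inf I) \<and>
     (\<forall>i\<in>I. finite (F i) \<and> F i \<union> Lam i (m i) d \<subseteq> Lam i i d) \<and>
     S = FD \<union> (\<Union>i\<in>I. F i \<union> Lam i (m i) d)"

definition upper_subsemigroup :: "bicyclic set \<Rightarrow> bool" where
  "upper_subsemigroup S \<longleftrightarrow>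
     subsemigroup S \<and> (\<exists>d I FD F m. upper_decomposition S d I FD F m)"

text \<open>The data of a decomposition are not unique: \<open>F 0\<close> and \<open>FD\<close> may repeat elements of
  \<open>Lam 0 (m 0) d\<close>. Such repetitions can always be removed.\<close>

definition zero_row_irredundant ::
  "nat \<Rightarrow> nat set \<Rightarrow> bicyclic set \<Rightarrow> (nat \<Rightarrow> bicyclic set) \<Rightarrow> (nat \<Rightarrow> nat) \<Rightarrow> bool"
where
  "zero_row_irredundant d I FD F m \<longleftrightarrow> (0 \<in> I \<longrightarrow> (FD \<union> F 0) \<inter> Lam 0 (m 0) d = {})"

lemma zero_row_irredundant_exists:
  assumes S: "upper_decomposition S d I FD F m"
  shows "\<exists>FD' F'. upper_decomposition S d I FD' F' m \<and> zero_row_irredundant d I FD' F' m"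
proof (cases "0 \<in> I")
  case False
  then show ?thesis using S by (auto simp: zero_row_irredundant_def)
next
  case True
  define FD' where "FD' = FD - Lam 0 (m 0) d"
  define F' where "F' = F(0 := F 0 - Lam 0 (m 0) d)"
  have eq: "F' i \<union> Lam i (m i) d = F i \<union> Lam i (m i) d" for i
    by (auto simp: F'_def)
  have fin: "finite (F' i)" if "finite (F i)" for i
    using that by (auto simp: F'_def)
  have "FD' \<union> (\<Union>i\<in>I. F i \<union> Lam i (m i) d) = FD \<union> (\<Union>i\<in>I. F i \<union> Lam i (m i) d)"
    using True by (auto simp: FD'_def)
  moreover have "FD' \<subseteq> FD" by (auto simp: FD'_def)
  ultimately have "upper_decomposition S d I FD' F' m"
    using S fin unfolding upper_decomposition_def eq by blast
  moreover have "zero_row_irredundant d I FD' F' m"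
    by (auto simp: zero_row_irredundant_def FD'_def F'_def)
  ultimately show ?thesis by blast
qed

end

theory Submission
  imports Defs
begin

text \<open>Every element \<open>AB i j\<close> of an upper subsemigroup lies on or above the
  diagonal, i.e. i \<le> j. If \<open>AB 0 n\<close> is a quotient \<open>sinv s * t\<close> with s
  above the diagonal, its zero first index forces s to be the identity, so t is
  \<open>AB 0 n\<close> itself; hence a left I-order contains \<open>R1\<close>
  (\<open>left_I_order_imp_R1_subset\<close>). Conversely, \<open>AB i j\<close> is
  \<open>sinv (AB 0 i) * AB 0 j\<close>, a quotient of elements of \<open>R1\<close>. As
  \<open>R1\<close> is the whole row of first index 0, the second criterion only reads off that row
  of S (\<open>upper_decomposition_row_zero\<close>): it consists of the points contributed by
  \<open>FD\<close> and \<open>F 0\<close> and the tail \<open>Lam 0 (m 0) d\<close>. The element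
  \<open>AB 0 1\<close> forces 0 \<in> I and d = 1, and then just the points before
  \<open>m 0\<close> remain to be supplied by \<open>FD\<close> and \<open>F 0\<close>.\<close>

lemma upper_decomposition_le:
  assumes "upper_decomposition S d I FD F m" "AB i j \<in> S"
  shows "i \<le> j"
  using assms unfolding upper_decomposition_def Diag_def Lam_def by blast

text \<open>The first index of \<open>AB j i * AB k l\<close> is at least j, so j = 0, then i = 0 by
  i \<le> j, and the left factor is the identity.\<close>

lemma sinv_mult_eq_row_zero:
  assumes "i \<le> j" and "AB 0 n = sinv (AB i j) * AB k l"
  shows "AB k l = AB 0 n"
  using assms by (auto simp: sinv_AB Let_def max_def split: if_splits)

lemma left_I_order_imp_R1_subset:
  assumes le: "\<And>i j. AB i j \<in> S \<Longrightarrow> i \<le> j" and S: "left_I_order S"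
  shows "R1 \<subseteq> S"
proof
  fix x assume "x \<in> R1"
  then obtain n where x: "x = AB 0 n" by (auto simp: R1_def)
  obtain s t where st: "s \<in> S" "t \<in> S" "AB 0 n = sinv s * t"
    using S unfolding left_I_order_def by blast
  then show "x \<in> S"
    using le sinv_mult_eq_row_zero by (cases s; cases t) (metis x)
qed

lemma R1_subset_imp_left_I_order:
  assumes "subsemigroup S" and "R1 \<subseteq> S"
  shows "left_I_order S"
proof -
  have "\<exists>s\<in>S. \<exists>t\<in>S. q = sinv s * t" for q
  proof (cases q)
    case (AB i j)
    then have "q = sinv (AB 0 i) * AB 0 j" by (simp add: sinv_AB Let_def)
    then show ?thesis using assms(2) by (auto simp: R1_def)
  qed
  then show ?thesis using assms(1) by (simp add: left_I_order_def)
qed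

text \<open>Each block lies in \<open>Lam i i d\<close>, so its elements have first index i; only
  block 0 and \<open>FD\<close> can meet row 0.\<close>

lemma upper_decomposition_row_zero:
  assumes S: "upper_decomposition S d I FD F m" and "0 \<in> I"
  shows "AB 0 j \<in> S \<longleftrightarrow> AB 0 j \<in> FD \<union> F 0 \<or> int d dvd int j \<and> m 0 \<le> j"
proof -
  have "i = 0" if "i \<in> I" "AB 0 j \<in> F i \<union> Lam i (m i) d" for i
    using S that unfolding upper_decomposition_def Lam_def by blast
  then have "AB 0 j \<in> S \<longleftrightarrow> AB 0 j \<in> FD \<union> F 0 \<union> Lam 0 (m 0) d"
    using S \<open>0 \<in> I\<close> unfolding upper_decomposition_def by blast
  then show ?thesis by (auto simp: Lam_def)
qed

text \<open>\<open>AB 0 1\<close> is off the diagonal, so it comes from a block inside some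
  \<open>Lam i i d\<close>; this gives i = 0 and makes d divide 1.\<close>

lemma upper_decomposition_AB_0_1:
  assumes S: "upper_decomposition S d I FD F m" and "AB 0 1 \<in> S"
  shows "0 \<in> I" and "d = 1"
proof -
  have "FD \<subseteq> Diag" using S unfolding upper_decomposition_def by blast
  then have "AB 0 1 \<notin> FD" by (auto simp: Diag_def)
  then obtain i where i: "i \<in> I" "AB 0 1 \<in> Lam i i d"
    using S \<open>AB 0 1 \<in> S\<close> unfolding upper_decomposition_def by blast
  then show "0 \<in> I" and "d = 1" by (auto simp: Lam_def)
qed

text \<open>An inclusion rather than an equality, since \<open>FD\<close> and \<open>F 0\<close> may
  repeat points of the tail.\<close>

lemma R1_subset_iff:
  assumes S: "upper_decomposition S d I FD F m"
  shows "R1 \<subseteq> S \<longleftrightarrow> 0 \<in> I \<and> d = 1 \<and> {AB 0 j |j. j < m 0} \<subseteq> FD \<union> F 0"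
proof
  assume R: "R1 \<subseteq> S"
  then have "0 \<in> I" "d = 1"
    using upper_decomposition_AB_0_1[OF S] by (auto simp: R1_def)
  moreover have "AB 0 j \<in> S" for j
    using R by (auto simp: R1_def)
  \<comment> \<open>The tail starts at \<open>m 0\<close>, so earlier points of row 0 must come from
    \<open>FD\<close> or \<open>F 0\<close>.\<close>
  ultimately show "0 \<in> I \<and> d = 1 \<and> {AB 0 j |j. j < m 0} \<subseteq> FD \<union> F 0"
    using upper_decomposition_row_zero[OF S] by (auto simp flip: not_le)
next
  assume A: "0 \<in> I \<and> d = 1 \<and> {AB 0 j |j. j < m 0} \<subseteq> FD \<union> F 0"
  have "AB 0 j \<in> S" for j
    using A upper_decomposition_row_zero[OF S, of j] by (cases "m 0 \<le> j") (auto simp: not_le)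
  then show "R1 \<subseteq> S" by (auto simp: R1_def)
qed

text \<open>The reverse inclusion, which upgrades \<open>R1_subset_iff\<close> to an equality: for d
  = 1 the tail contains every \<open>AB 0 j\<close> with j \<ge> m 0, and irredundancy excludes
  these.\<close>

lemma zero_row_irredundant_subset:
  assumes S: "upper_decomposition S d I FD F m"
    and irr: "zero_row_irredundant d I FD F m" and I: "0 \<in> I" and d: "d = 1"
  shows "FD \<union> F 0 \<subseteq> {AB 0 j |j. j < m 0}"
proof
  fix x assume x: "x \<in> FD \<union> F 0"
  \<comment> \<open>With minimum 0, \<open>FD\<close> can contain at most the identity, so it too
    lies in row 0.\<close>
  have "Inf I = 0" using I cInf_lower[of 0 I] by simp
  then have "FD \<subseteq> Diag \<inter> Lset 0" "F 0 \<subseteq> Lam 0 0 d"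
    using S I unfolding upper_decomposition_def by auto
  moreover have "Diag \<inter> Lset 0 = {AB 0 0}" by (auto simp: Diag_def Lset_def)
  moreover have "Lam 0 0 d \<subseteq> range (AB 0)" by (auto simp: Lam_def)
  ultimately obtain j where j: "x = AB 0 j" using x by blast
  have "x \<notin> Lam 0 (m 0) d" using irr I x unfolding zero_row_irredundant_def by blast
  then show "x \<in> {AB 0 j |j. j < m 0}" using j d by (auto simp: Lam_def)
qed

theorem proposition3p5:
  fixes S :: "bicyclic set"
  assumes "upper_subsemigroup S"
  shows "(left_I_order S \<longleftrightarrow> R1 \<subseteq> S) \<and>
    (\<forall>d I FD F m. upper_decomposition S d I FD F m \<longrightarrow>
       (zero_row_irredundant d I FD F m \<longrightarrow>
          (R1 \<subseteq> S \<longleftrightarrow> 0 \<in> I \<and> d = 1 \<and> FD \<union> F 0 = {AB 0 j |j. j < m 0})) \<and>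
       (R1 \<subseteq> S \<longleftrightarrow> 0 \<in> I \<and> d = 1 \<and> {AB 0 j |j. j < m 0} \<subseteq> FD \<union> F 0))"
proof (intro conjI allI impI)
  have "\<And>i j. AB i j \<in> S \<Longrightarrow> i \<le> j" "subsemigroup S"
    using assms upper_decomposition_le unfolding upper_subsemigroup_def by blast+
  then show "left_I_order S \<longleftrightarrow> R1 \<subseteq> S"
    using left_I_order_imp_R1_subset R1_subset_imp_left_I_order by blast
next
  fix d I FD F m
  assume S: "upper_decomposition S d I FD F m"
  show iff: "R1 \<subseteq> S \<longleftrightarrow> 0 \<in> I \<and> d = 1 \<and> {AB 0 j |j. j < m 0} \<subseteq> FD \<union> F 0"
    by (rule R1_subset_iff[OF S])
  assume "zero_row_irredundant d I FD F m"
  then show "R1 \<subseteq> S \<longleftrightarrow> 0 \<in> I \<and> d = 1 \<and> FD \<union> F 0 = {AB 0 j |j. j < m 0}"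
    unfolding iff using zero_row_irredundant_subset[OF S] by blast
qed

end
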